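(* Let $X$ be a finite set of alternatives with $|X|=m\geq 3$ and let $N=\{1,\dots,n\}$ with $n\geq 2$. The range of the Pareto correspondence $G_{Pa}: L(X)^N\to 2^X\setminus\{\varnothing\}$ consists of all non-empty subsets of $X$; that is, for every non-empty $S\subseteq X$ there is a profile $u\in L(X)^N$ with $G_{Pa}(u)=S$.
   Context: $L(X)$ is the set of strong orderings on $X$: complete (any two distinct alternatives are comparable), asymmetric, transitive relations. A profile is $u=(u(1),\dots,u(n))\in L(X)^N$; $x\succ_{u(i)}y$ means $x$ ranks above $y$ in $u(i)$. A social choice correspondence is a map $G$ from $L(X)^N$ to non-empty subsets of $X$; its range is the collection of all sets $S$ such that $G(u)=S$ for some profile $u$. Alternative $y$ is Pareto dominated by $x$ at $u$ if $x\succ_{u(i)}y$ for all $i\in N$; $y$ is Pareto optimal at $u$ if it is Pareto dominated by no other alternative at $u$. $G_{Pa}(u)=\{x\in X: x \text{ is Pareto optimal at } u\}$, which is always non-empty. *)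

theory Defs
  imports Main "HOL-Library.FuncSet"
begin

text \<open>
  Orderings are relations as sets of pairs, \<open>(x, y) \<in> r\<close> meaning that \<open>x\<close> ranks above \<open>y\<close>.
\<close>

definition strong_orderings :: "'a set \<Rightarrow> 'a rel set" where
  "strong_orderings X = {r. r \<subseteq> X \<times> X \<and> total_on X r \<and> asym r \<and> trans r}"

text \<open>
  Profiles are extensional functions (fixed to \<open>undefined\<close> off \<open>N\<close>), so that this is
  exactly the power of the set of strong orderings by \<open>N\<close>.
\<close>

definition profiles :: "'a set \<Rightarrow> 'i set \<Rightarrow> ('i \<Rightarrow> 'a rel) set" where
  "profiles X N = N \<rightarrow>\<^sub>E strong_orderings X"

definition pareto_dominates :: "'i set \<Rightarrow> ('i \<Rightarrow> 'a rel) \<Rightarrow> 'a \<Rightarrow> 'a \<Rightarrow> bool" where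
  "pareto_dominates N u x y \<longleftrightarrow> (\<forall>i\<in>N. (x, y) \<in> u i)"

definition pareto_optimal :: "'a set \<Rightarrow> 'i set \<Rightarrow> ('i \<Rightarrow> 'a rel) \<Rightarrow> 'a \<Rightarrow> bool" where
  "pareto_optimal X N u y \<longleftrightarrow> y \<in> X \<and> \<not> (\<exists>x\<in>X. x \<noteq> y \<and> pareto_dominates N u x y)"

definition pareto_correspondence :: "'a set \<Rightarrow> 'i set \<Rightarrow> ('i \<Rightarrow> 'a rel) \<Rightarrow> 'a set" where
  "pareto_correspondence X N u = {x \<in> X. pareto_optimal X N u x}"

definition scc_range ::
  "'a set \<Rightarrow> 'i set \<Rightarrow> (('i \<Rightarrow> 'a rel) \<Rightarrow> 'a set) \<Rightarrow> 'a set set" where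
  "scc_range X N G = {S. \<exists>u\<in>profiles X N. G u = S}"

end

theory Submission
  imports Defs
begin

text \<open>
  No profile leaves the Pareto set empty, since the top alternative of any single voter is
  dominated by nothing (\<open>pareto_correspondence_nonempty\<close>). Conversely, a non-empty \<open>S\<close> is the
  Pareto set of a profile with only two kinds of voters. All of them rank \<open>S\<close> above its complement,
  so everything outside \<open>S\<close> is dominated; inside \<open>S\<close> they rank in opposite ways, so that nothing
  in \<open>S\<close> is dominated. Two voters suffice to have both kinds present
  (\<open>pareto_correspondence_reversed_on\<close>).
\<close>

lemma strong_ordering_has_top:
  assumes "r \<in> strong_orderings X" and "finite X" and "X \<noteq> {}"
  obtains z where "z \<in> X" and "\<And>y. (y, z) \<notin> r"
proof -
  have sub: "r \<subseteq> X \<times> X" and tr: "trans r" and asy: "asym r"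
    using assms(1) by (auto simp: strong_orderings_def)
  have "finite r"
    using sub assms(2) by (meson finite_SigmaI finite_subset)
  moreover have "acyclic r"
    using tr asy by (auto simp: acyclic_def dest: asymD)
  ultimately have "wf r"
    by (rule finite_acyclic_wf)
  then obtain z where "z \<in> X" and "\<And>y. (y, z) \<in> r \<Longrightarrow> y \<notin> X"
    using assms(3) by (metis wfE_min all_not_in_conv)
  then show thesis
    using sub that by blast
qed

lemma pareto_correspondence_nonempty:
  assumes "u \<in> profiles X N" and "i \<in> N" and "finite X" and "X \<noteq> {}"
  shows "pareto_correspondence X N u \<noteq> {}"
proof -
  have "u i \<in> strong_orderings X"
    using assms(1,2) by (auto simp: profiles_def)
  then obtain z where "z \<in> X" and "\<And>y. (y, z) \<notin> u i"
    using assms(3,4) by (rule strong_ordering_has_top) blast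
  then have "z \<in> pareto_correspondence X N u"
    using assms(2)
    by (auto simp: pareto_correspondence_def pareto_optimal_def pareto_dominates_def)
  then show ?thesis by blast
qed

definition ordering_by_key :: "'a set \<Rightarrow> ('a \<Rightarrow> 'b::linorder) \<Rightarrow> 'a rel" where
  "ordering_by_key X k = {(x, y). x \<in> X \<and> y \<in> X \<and> k x < k y}"

lemma strong_ordering_by_key:
  assumes "inj_on k X"
  shows "ordering_by_key X k \<in> strong_orderings X"
proof -
  have "total_on X (ordering_by_key X k)"
    unfolding total_on_def ordering_by_key_def
    using assms by (fastforce dest: inj_onD simp: not_less_iff_gr_or_eq)
  moreover have "asym (ordering_by_key X k)"
    by (auto intro!: asymI simp: ordering_by_key_def)
  moreover have "trans (ordering_by_key X k)"
    by (auto intro!: transI simp: ordering_by_key_def)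
  ultimately show ?thesis
    by (auto simp: strong_orderings_def ordering_by_key_def)
qed

text \<open>
  Unanimity about \<open>S\<close> versus its complement removes exactly the complement, provided that the
  disagreement of \<open>i\<close> and \<open>j\<close> inside \<open>S\<close> protects the members of \<open>S\<close> from one another.
\<close>

lemma pareto_correspondence_reversed_on:
  assumes S: "S \<subseteq> X" "S \<noteq> {}"
    and above: "\<And>l s y. \<lbrakk>l \<in> N; s \<in> S; y \<in> X - S\<rbrakk> \<Longrightarrow> (s, y) \<in> u l \<and> (y, s) \<notin> u l"
    and ij: "i \<in> N" "j \<in> N"
    and reversed: "\<And>s t. \<lbrakk>s \<in> S; t \<in> S; (s, t) \<in> u i\<rbrakk> \<Longrightarrow> (s, t) \<notin> u j"
  shows "pareto_correspondence X N u = S"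
proof
  obtain s where "s \<in> S" using S(2) by blast
  then show "pareto_correspondence X N u \<subseteq> S"
    using S(1) above
    by (fastforce simp: pareto_correspondence_def pareto_optimal_def pareto_dominates_def)
  have "\<not> pareto_dominates N u x t" if "t \<in> S" "x \<in> X" for x t
    using that ij above[OF ij(1)] reversed unfolding pareto_dominates_def by blast
  then show "S \<subseteq> pareto_correspondence X N u"
    using S(1) by (auto simp: pareto_correspondence_def pareto_optimal_def)
qed

lemma every_subset_is_pareto_set:
  assumes "finite X" and "S \<subseteq> X" and "S \<noteq> {}" and ij: "i \<in> N" "j \<in> N" "i \<noteq> j"
  shows "\<exists>u \<in> profiles X N. pareto_correspondence X N u = S"
proof -
  obtain f :: "'a \<Rightarrow> nat" where inj: "inj_on f X"
    using finite_imp_inj_to_nat_seg[OF assms(1)] by blast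
  \<comment> \<open>Both keys are positive off \<open>S\<close>, thanks to the shift by 1, and at most 0 on \<open>S\<close>,
     where one decreases in \<open>f\<close> and the other increases.\<close>
  define k where "k x = (if x \<in> S then - int (f x) else int (f x) + 1)" for x
  obtain B where B: "\<And>x. x \<in> X \<Longrightarrow> f x < B"
    using assms(1) by (metis finite_imageI finite_nat_set_iff_bounded imageI)
  define k' where "k' x = (if x \<in> S then int (f x) - int B else int (f x) + 1)" for x
  have injk: "inj_on k X" "inj_on k' X"
    using inj B by (force simp: inj_on_def k_def k'_def split: if_splits)+
  define u where "u = (\<lambda>l\<in>N. if l = i then ordering_by_key X k else ordering_by_key X k')"
  have "u \<in> profiles X N"
    using injk by (auto simp: u_def profiles_def strong_ordering_by_key)
  moreover have "pareto_correspondence X N u = S"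
  proof (rule pareto_correspondence_reversed_on[OF assms(2,3) _ ij(1,2)])
    fix l s y assume "l \<in> N" "s \<in> S" "y \<in> X - S"
    moreover from this have "s \<in> X" "f s < B" using assms(2) B by auto
    ultimately show "(s, y) \<in> u l \<and> (y, s) \<notin> u l"
      by (auto simp: u_def ordering_by_key_def k_def k'_def)
  next
    fix s t assume "s \<in> S" "t \<in> S" "(s, t) \<in> u i"
    then show "(s, t) \<notin> u j"
      using ij by (auto simp: u_def ordering_by_key_def k_def k'_def)
  qed
  ultimately show ?thesis by blast
qed

theorem mainTheorem1:
  fixes X :: "'a set" and m n :: nat
  assumes "finite X" and "card X = m" and "m \<ge> 3" and "n \<ge> 2"
  shows "scc_range X {1..n} (pareto_correspondence X {1..n}) = {S. S \<subseteq> X \<and> S \<noteq> {}}"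
proof -
  have "X \<noteq> {}" and v: "1 \<in> {1..n}" "2 \<in> {1..n}"
    using assms by auto
  show ?thesis
  proof (intro set_eqI iffI)
    fix S assume "S \<in> scc_range X {1..n} (pareto_correspondence X {1..n})"
    then obtain u where u: "u \<in> profiles X {1..n}" "S = pareto_correspondence X {1..n} u"
      by (auto simp: scc_range_def)
    have "S \<noteq> {}"
      unfolding u(2) by (rule pareto_correspondence_nonempty[OF u(1) v(1) assms(1) \<open>X \<noteq> {}\<close>])
    moreover have "S \<subseteq> X"
      unfolding u(2) by (auto simp: pareto_correspondence_def)
    ultimately show "S \<in> {S. S \<subseteq> X \<and> S \<noteq> {}}" by blast
  next
    fix S assume "S \<in> {S. S \<subseteq> X \<and> S \<noteq> {}}"
    then show "S \<in> scc_range X {1..n} (pareto_correspondence X {1..n})"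
      using every_subset_is_pareto_set[OF assms(1) _ _ v] by (auto simp: scc_range_def)
  qed
qed

end
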